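(* Let $n\ge 2$ and let $X\subset\Omega_n$ be a hereditary subshift. Then the following conditions are equivalent: (1) The topological entropy of $X$ is positive. (2) There exist points $x,y\in X$ such that $F_{xy}(t)<1$ for some $t>0$. (3) $X$ is DC$3$-chaotic. (4) $X$ is DC$2$-chaotic.
   Context: $\mathbb{N}=\{1,2,\ldots\}$. For $n\ge 2$, $\Lambda_n=\{0,1,\ldots,n-1\}$ has the discrete topology and $\Omega_n=\Lambda_n^{\mathbb{N}}$ the product topology; $\sigma\colon\Omega_n\to\Omega_n$, $(\sigma(\omega))_i=\omega_{i+1}$, is the shift. $\Omega_n$ carries the metric $\rho(\omega,\gamma)=n^{-\min\{k\in\mathbb{N}:\omega_k\ne\gamma_k\}}$ for $\omega\neq\gamma$ and $\rho(\omega,\omega)=0$. A subshift is a nonempty closed set $X\subset\Omega_n$ with $\sigma(X)\subset X$. A subshift $X\subset\Omega_n$ is hereditary if whenever $\omega\in X$, $\omega'\in\Omega_n$ and $\omega'_i\le\omega_i$ for all $i\in\mathbb{N}$, then $\omega'\in X$. $\mathcal{L}_k(X)$ is the set of words of length $k$ appearing (as blocks of consecutive symbols) in some element of $X$, and the topological entropy is $h(X)=\lim_{k\to\infty}\frac{1}{k}\log\#\mathcal{L}_k(X)$ (logarithm base 2). For $x,y\in X$ and $t\in\mathbb{R}$ put $F_{xy}(t)=\liminf_{m\to\infty}\frac1m\#\{0\le j\le m-1:\rho(\sigma^j(x),\sigma^j(y))<t\}$ and $F^*_{xy}(t)=\limsup_{m\to\infty}\frac1m\#\{0\le j\le m-1:\rho(\sigma^j(x),\sigma^j(y))<t\}$.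 A pair $(x,y)$ is DC$2$-scrambled if $F^*_{xy}(t)=1$ for all $t>0$ and $F_{xy}(s)<1$ for some $s>0$; it is DC$3$-scrambled if $F_{xy}(t)<F^*_{xy}(t)$ for all $t$ in some interval of positive length. $X$ is DC$i$-chaotic if there is an uncountable set $S\subset X$ such that every pair of distinct points of $S$ is DC$i$-scrambled. *)

theory Defs
  imports "HOL-Analysis.Analysis"
begin

text \<open>
  Sequences are indexed by \<open>{0,1,2,\<dots>}\<close> instead of \<open>{1,2,3,\<dots>}\<close>: the mathematical symbol
  \<open>\<omega>\<^sub>k\<close> (\<open>k \<ge> 1\<close>) is \<open>w (k - 1)\<close>. This is why \<open>Suc\<close> appears in the exponent of the metric.
\<close>

definition full_shift_topology :: "nat \<Rightarrow> (nat \<Rightarrow> nat) topology" where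
  "full_shift_topology n = product_topology (\<lambda>_. discrete_topology {..<n}) UNIV"

abbreviation full_shift :: "nat \<Rightarrow> (nat \<Rightarrow> nat) set" where
  "full_shift n \<equiv> topspace (full_shift_topology n)"

definition shift :: "(nat \<Rightarrow> nat) \<Rightarrow> (nat \<Rightarrow> nat)" where
  "shift w = (\<lambda>i. w (Suc i))"

definition seq_dist :: "nat \<Rightarrow> (nat \<Rightarrow> nat) \<Rightarrow> (nat \<Rightarrow> nat) \<Rightarrow> real" where
  "seq_dist n w v = (if w = v then 0 else 1 / real n ^ Suc (LEAST k. w k \<noteq> v k))"

definition subshift :: "nat \<Rightarrow> (nat \<Rightarrow> nat) set \<Rightarrow> bool" where
  "subshift n X \<longleftrightarrow> X \<noteq> {} \<and> closedin (full_shift_topology n) X \<and> shift ` X \<subseteq> X"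

definition hereditary :: "nat \<Rightarrow> (nat \<Rightarrow> nat) set \<Rightarrow> bool" where
  "hereditary n X \<longleftrightarrow>
     (\<forall>w\<in>X. \<forall>v\<in>full_shift n. (\<forall>i. v i \<le> w i) \<longrightarrow> v \<in> X)"

definition language :: "(nat \<Rightarrow> nat) set \<Rightarrow> nat \<Rightarrow> nat list set" where
  "language X k = {map (\<lambda>j. w (i + j)) [0..<k] | w i. w \<in> X}"

text \<open>
  The limit exists for every subshift, by subadditivity of the sequence
  \<open>log 2 (card (language X k))\<close>.
\<close>

definition topological_entropy :: "(nat \<Rightarrow> nat) set \<Rightarrow> real" where
  "topological_entropy X = lim (\<lambda>k. log 2 (real (card (language X k))) / real k)"

definition close_freq :: "nat \<Rightarrow> (nat \<Rightarrow> nat) \<Rightarrow> (nat \<Rightarrow> nat) \<Rightarrow> real \<Rightarrow> nat \<Rightarrow> real" where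
  "close_freq n x y t m =
     real (card {j. j < m \<and> seq_dist n ((shift ^^ j) x) ((shift ^^ j) y) < t}) / real m"

text \<open>
  The values lie in \<open>[0,1]\<close>; \<open>ereal\<close> is used only because \<open>liminf\<close> and \<open>limsup\<close>
  need a complete lattice.
\<close>

definition lower_dist_fun :: "nat \<Rightarrow> (nat \<Rightarrow> nat) \<Rightarrow> (nat \<Rightarrow> nat) \<Rightarrow> real \<Rightarrow> ereal" where
  "lower_dist_fun n x y t = liminf (\<lambda>m. ereal (close_freq n x y t m))"

definition upper_dist_fun :: "nat \<Rightarrow> (nat \<Rightarrow> nat) \<Rightarrow> (nat \<Rightarrow> nat) \<Rightarrow> real \<Rightarrow> ereal" where
  "upper_dist_fun n x y t = limsup (\<lambda>m. ereal (close_freq n x y t m))"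

definition DC2_scrambled :: "nat \<Rightarrow> (nat \<Rightarrow> nat) \<Rightarrow> (nat \<Rightarrow> nat) \<Rightarrow> bool" where
  "DC2_scrambled n x y \<longleftrightarrow>
     (\<forall>t>0. upper_dist_fun n x y t = 1) \<and> (\<exists>s>0. lower_dist_fun n x y s < 1)"

text \<open>Every interval of positive length contains a bounded open one, so those suffice.\<close>

definition DC3_scrambled :: "nat \<Rightarrow> (nat \<Rightarrow> nat) \<Rightarrow> (nat \<Rightarrow> nat) \<Rightarrow> bool" where
  "DC3_scrambled n x y \<longleftrightarrow>
     (\<exists>a b. a < b \<and> (\<forall>t\<in>{a<..<b}. lower_dist_fun n x y t < upper_dist_fun n x y t))"

definition DC2_chaotic :: "nat \<Rightarrow> (nat \<Rightarrow> nat) set \<Rightarrow> bool" where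
  "DC2_chaotic n X \<longleftrightarrow>
     (\<exists>S\<subseteq>X. uncountable S \<and> (\<forall>x\<in>S. \<forall>y\<in>S. x \<noteq> y \<longrightarrow> DC2_scrambled n x y))"

definition DC3_chaotic :: "nat \<Rightarrow> (nat \<Rightarrow> nat) set \<Rightarrow> bool" where
  "DC3_chaotic n X \<longleftrightarrow>
     (\<exists>S\<subseteq>X. uncountable S \<and> (\<forall>x\<in>S. \<forall>y\<in>S. x \<noteq> y \<longrightarrow> DC3_scrambled n x y))"

end

theory Submission
  imports Defs
begin

text \<open>
  All four conditions are equivalent to the existence of a point of \<open>X\<close> whose support has positive
  upper density. If two points do not get close on average, they differ on a set of positive upper
  density, which is covered by their two supports. Conversely, cut \<open>\<nat>\<close> into blocks, each much longer
  than everything before it and rich in the support of \<open>x\<close>; by heredity, restricting \<open>x\<close> to unions of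
  blocks indexed by an almost disjoint family gives an uncountable DC2-scrambled set.
  Heredity also yields at least \<open>2\<^sup>s\<close> words from a word with \<open>s\<close> nonzero letters, so that positive
  density gives positive entropy. If no point has all its prefixes of density at least \<open>b\<close>, then by
  compactness every word of length \<open>m\<close> has at most \<open>b m + L\<close> nonzero letters; weighting words
  by \<open>q\<close> to the number of nonzero letters bounds the entropy by
  \<open>log\<^sub>2 (1 + (n - 1) q) + b log\<^sub>2 (1 / q)\<close>, which is arbitrarily small.
\<close>

section \<open>Counting functions and the density of supports\<close>

definition hits :: "(nat \<Rightarrow> bool) \<Rightarrow> nat \<Rightarrow> nat" where
  "hits P m = card {j. j < m \<and> P j}"

lemma hits_0 [simp]: "hits P 0 = 0"
  by (simp add: hits_def)

lemma hits_Suc [simp]: "hits P (Suc m) = hits P m + (if P m then 1 else 0)"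
proof -
  have "{j. j < Suc m \<and> P j} = (if P m then insert m {j. j < m \<and> P j} else {j. j < m \<and> P j})"
    by (auto simp: less_Suc_eq)
  then show ?thesis
    by (simp add: hits_def)
qed

lemma hits_eq_sum: "hits P m = (\<Sum>j<m. if P j then 1 else 0)"
  by (induction m) auto

lemma hits_mono: "(\<And>j. j < m \<Longrightarrow> P j \<Longrightarrow> Q j) \<Longrightarrow> hits P m \<le> hits Q m"
  unfolding hits_def by (intro card_mono) auto

lemma hits_disj: "hits (\<lambda>j. P j \<or> Q j) m \<le> hits P m + hits Q m"
  by (induction m) auto

lemma hits_not: "hits P m + hits (\<lambda>j. \<not> P j) m = m"
  by (induction m) auto

lemma hits_le: "hits P m \<le> m"
  using hits_not[of P m] by simp

lemma hits_add: "hits P (m + k) = hits P m + hits (\<lambda>j. P (m + j)) k"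
  by (induction k) auto

text \<open>Union bound over the \<open>k\<close> offsets: shifting by \<open>i < k\<close> brings
  in at most \<open>k\<close> positions from beyond \<open>m\<close>. This passes from windows that
  differ to single coordinates that differ.\<close>

lemma hits_window: "hits (\<lambda>j. \<exists>i<k. P (j + i)) m \<le> k * (hits P m + k)"
proof (induction k)
  case (Suc k)
  have "hits (\<lambda>j. \<exists>i<Suc k. P (j + i)) m \<le> hits (\<lambda>j. (\<exists>i<k. P (j + i)) \<or> P (j + k)) m"
    by (intro hits_mono) (auto simp: less_Suc_eq)
  also have "\<dots> \<le> hits (\<lambda>j. \<exists>i<k. P (j + i)) m + hits (\<lambda>j. P (j + k)) m"
    by (rule hits_disj)
  also have "hits (\<lambda>j. P (j + k)) m \<le> hits P m + k"
  proof -
    have "hits (\<lambda>j. P (j + k)) m \<le> hits P (k + m)"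
      by (simp add: hits_add add.commute)
    also have "\<dots> = hits P m + hits (\<lambda>j. P (m + j)) k"
      by (metis add.commute hits_add)
    also have "\<dots> \<le> hits P m + k"
      by (simp add: hits_le)
    finally show ?thesis .
  qed
  finally show ?case
    using Suc by (simp add: algebra_simps)
qed (simp add: hits_def)

text \<open>This implies upper density at least \<open>d\<close> and follows from upper density
  above \<open>d\<close>; some \<open>d > 0\<close> exists iff the support has positive upper
  density. The "frequently" form gives usable times \<open>m\<close> directly.\<close>

definition support_density :: "real \<Rightarrow> (nat \<Rightarrow> nat) \<Rightarrow> bool" where
  "support_density d x \<longleftrightarrow> (\<exists>\<^sub>F m in sequentially. d * real m \<le> real (hits (\<lambda>j. x j \<noteq> 0) m))"

section \<open>Distribution functions\<close>

lemma shift_funpow: "(shift ^^ j) x = (\<lambda>i. x (i + j))"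
  by (induction j arbitrary: x) (auto simp: shift_def funpow_Suc_right simp del: funpow.simps)

text \<open>The first difference \<open>L\<close> is counted from 0, so the distance is
  \<open>1 / n ^ (L + 1)\<close>, which is below \<open>1 / n ^ k\<close> exactly when
  \<open>k \<le> L\<close>. Thresholds of this form turn closeness into agreement of
  windows.\<close>

lemma seq_dist_less_iff:
  assumes "n \<ge> 2"
  shows "seq_dist n w v < 1 / real n ^ k \<longleftrightarrow> (\<forall>i<k. w i = v i)"
proof (cases "w = v")
  case True
  then show ?thesis
    using assms by (simp add: seq_dist_def)
next
  case False
  define L where "L = (LEAST k. w k \<noteq> v k)"
  have L: "w L \<noteq> v L"
    unfolding L_def by (rule LeastI_ex) (use False in auto)
  have less: "w i = v i" if "i < L" for i
    using not_less_Least[of i "\<lambda>k. w k \<noteq> v k"] that by (auto simp: L_def)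
  have "seq_dist n w v < 1 / real n ^ k \<longleftrightarrow> real n ^ k < real n ^ Suc L"
    using False assms by (simp add: seq_dist_def L_def field_simps)
  also have "\<dots> \<longleftrightarrow> k \<le> L"
    using assms by (subst power_strict_increasing_iff) auto
  also have "\<dots> \<longleftrightarrow> (\<forall>i<k. w i = v i)"
    using L less by (meson leI less_le_trans)
  finally show ?thesis .
qed

lemma seq_dist_nonneg: "0 \<le> seq_dist n w v"
  by (simp add: seq_dist_def)

lemma close_freq_eq:
  "close_freq n x y t m = real (hits (\<lambda>j. seq_dist n ((shift ^^ j) x) ((shift ^^ j) y) < t) m) / real m"
  by (simp add: close_freq_def hits_def)

lemma close_freq_power:
  assumes "n \<ge> 2"
  shows "close_freq n x y (1 / real n ^ k) m = real (hits (\<lambda>j. \<forall>i<k. x (j + i) = y (j + i)) m) / real m"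
  unfolding close_freq_eq seq_dist_less_iff[OF assms] by (simp add: shift_funpow add.commute)

lemma close_freq_nonneg: "0 \<le> close_freq n x y t m"
  by (simp add: close_freq_def)

lemma close_freq_le_1: "close_freq n x y t m \<le> 1"
  using hits_le by (auto simp: close_freq_eq divide_le_eq_1)

lemma close_freq_mono: "s \<le> t \<Longrightarrow> close_freq n x y s m \<le> close_freq n x y t m"
  by (auto simp: close_freq_eq intro!: divide_right_mono hits_mono)

lemma ex_inverse_power_less:
  assumes "n \<ge> 2" "t > 0"
  obtains k where "1 / real n ^ k < t"
proof -
  obtain k where "(1 / real n) ^ k < t"
    using assms real_arch_pow_inv[of t "1 / real n"] by auto
  then show ?thesis
    using that by (simp add: power_one_over)
qed

text \<open>The strict inequality leaves room for a real constant \<open>c\<close>, so later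
  arguments avoid \<open>ereal\<close>.\<close>

lemma lower_dist_fun_less_1_iff:
  "lower_dist_fun n x y t < 1 \<longleftrightarrow> (\<exists>c<1. \<exists>\<^sub>F m in sequentially. close_freq n x y t m \<le> c)"
proof
  assume "lower_dist_fun n x y t < 1"
  then obtain y' where y': "y' < 1" "\<exists>\<^sub>F m in sequentially. ereal (close_freq n x y t m) \<le> y'"
    unfolding lower_dist_fun_def not_le[symmetric] le_Liminf_iff frequently_def by (auto simp: not_le)
  then obtain m where "ereal (close_freq n x y t m) \<le> y'"
    by (meson frequently_ex)
  \<comment> \<open>Frequencies are nonnegative, which excludes minus infinity as the value of
    \<open>y'\<close>.\<close>
  then have "0 \<le> y'"
    using close_freq_nonneg[of n x y t m] by (meson ereal_less_eq(5) order_trans)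
  with y'(1) obtain c where "y' = ereal c" "c < 1"
    by (cases y') auto
  with y' show "\<exists>c<1. \<exists>\<^sub>F m in sequentially. close_freq n x y t m \<le> c"
    by auto
next
  assume "\<exists>c<1. \<exists>\<^sub>F m in sequentially. close_freq n x y t m \<le> c"
  then obtain c where c: "c < 1" "\<exists>\<^sub>F m in sequentially. close_freq n x y t m \<le> c"
    by auto
  show "lower_dist_fun n x y t < 1"
  proof (rule ccontr)
    assume "\<not> lower_dist_fun n x y t < 1"
    then have "\<forall>\<^sub>F m in sequentially. ereal c < ereal (close_freq n x y t m)"
      unfolding lower_dist_fun_def not_less le_Liminf_iff using c(1) by (metis ereal_less(3))
    with c(2) show False
      by (auto simp: frequently_def not_le)
  qed
qed

lemma upper_dist_fun_le_1: "upper_dist_fun n x y t \<le> 1"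
  unfolding upper_dist_fun_def by (rule Limsup_bounded) (simp add: close_freq_le_1)

lemma upper_dist_fun_eq_1I:
  assumes "\<And>e. e > 0 \<Longrightarrow> \<exists>\<^sub>F m in sequentially. 1 - e \<le> close_freq n x y t m"
  shows "upper_dist_fun n x y t = 1"
proof (rule ccontr)
  assume "upper_dist_fun n x y t \<noteq> 1"
  then have "upper_dist_fun n x y t < 1"
    using upper_dist_fun_le_1[of n x y t] by auto
  then obtain c where c: "upper_dist_fun n x y t < ereal c" "ereal c < 1"
    using ereal_dense2 by blast
  then have "\<forall>\<^sub>F m in sequentially. ereal (close_freq n x y t m) < ereal c"
    unfolding upper_dist_fun_def by (intro Limsup_lessD)
  moreover have "\<exists>\<^sub>F m in sequentially. c \<le> close_freq n x y t m"
    using assms[of "1 - c"] c(2) by simp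
  ultimately show False
    by (auto simp: frequently_def not_le)
qed

lemma lower_dist_fun_mono: "s \<le> t \<Longrightarrow> lower_dist_fun n x y s \<le> lower_dist_fun n x y t"
  unfolding lower_dist_fun_def by (intro Liminf_mono) (simp add: close_freq_mono)

lemma DC2_scrambled_imp_DC3_scrambled:
  assumes "DC2_scrambled n x y"
  shows "DC3_scrambled n x y"
proof -
  obtain s where "s > 0" "lower_dist_fun n x y s < 1"
    using assms by (auto simp: DC2_scrambled_def)
  moreover have "lower_dist_fun n x y t < upper_dist_fun n x y t" if "t \<in> {0<..<s}" for t
    using that calculation lower_dist_fun_mono[of t s n x y] assms
    by (auto simp: DC2_scrambled_def intro: order_le_less_trans)
  ultimately show ?thesis
    unfolding DC3_scrambled_def by blast
qed

lemma DC3_scrambled_imp_lower_less_1: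
  assumes "DC3_scrambled n x y"
  obtains t where "t > 0" "lower_dist_fun n x y t < 1"
proof -
  obtain a b where ab: "a < b"
    "\<And>t. t \<in> {a<..<b} \<Longrightarrow> lower_dist_fun n x y t < upper_dist_fun n x y t"
    using assms by (auto simp: DC3_scrambled_def)
  then obtain t where t: "lower_dist_fun n x y t < upper_dist_fun n x y t"
    using dense by (metis greaterThanLessThan_iff)
  \<comment> \<open>The interval of a DC3 pair might reach below 0, but for \<open>t \<le> 0\<close>
    no distance is less than \<open>t\<close> and the two functions coincide.\<close>
  have "t > 0"
  proof (rule ccontr)
    assume "\<not> t > 0"
    then have "\<not> seq_dist n u v < t" for u v
      using seq_dist_nonneg[of n u v] by linarith
    then have "lower_dist_fun n x y t = upper_dist_fun n x y t"
      unfolding lower_dist_fun_def upper_dist_fun_def close_freq_def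
      by (simp add: Liminf_const Limsup_const)
    with t show False
      by simp
  qed
  with t that show ?thesis
    using upper_dist_fun_le_1 by (meson order_less_le_trans)
qed

text \<open>Later yields the injectivity of the parametrization of the scrambled set.\<close>

lemma not_DC2_scrambled_refl: "\<not> DC2_scrambled n x x"
proof
  assume "DC2_scrambled n x x"
  then obtain s c where "s > 0" "c < 1" and c: "\<exists>\<^sub>F m in sequentially. close_freq n x x s m \<le> c"
    by (auto simp: DC2_scrambled_def lower_dist_fun_less_1_iff)
  have "close_freq n x x s m = 1" if "m > 0" for m
    using that \<open>s > 0\<close> by (simp add: close_freq_def seq_dist_def)
  then have "\<forall>\<^sub>F m in sequentially. \<not> close_freq n x x s m \<le> c"
    using \<open>c < 1\<close> by (auto intro: eventually_mono[OF eventually_gt_at_top[of 0]])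
  with c show False
    by (simp add: frequently_def)
qed

lemma lower_less_1_imp_support_density:
  assumes "n \<ge> 2" "t > 0" "lower_dist_fun n x y t < 1"
  obtains d z where "d > 0" "z \<in> {x, y}" "support_density d z"
proof -
  obtain c where c: "c < 1" "\<exists>\<^sub>F m in sequentially. close_freq n x y t m \<le> c"
    using assms by (auto simp: lower_dist_fun_less_1_iff)
  obtain k where k: "1 / real n ^ k < t"
    using ex_inverse_power_less assms by blast
  \<comment> \<open>One factor 2 absorbs the boundary error \<open>k * k\<close> of
    \<open>hits_window\<close>, the other shares the differences between two supports.
    \<open>Suc k\<close> avoids dividing by 0 when \<open>k = 0\<close>.\<close>
  define d where "d = (1 - c) / (4 * real (Suc k))"
  have "d > 0"
    using c by (simp add: d_def)
  let ?D = "\<lambda>j. x j \<noteq> y j"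
  let ?X = "\<lambda>m. hits (\<lambda>j. x j \<noteq> 0) m" and ?Y = "\<lambda>m. hits (\<lambda>j. y j \<noteq> 0) m"
  obtain N where N: "2 * real k * real k / (1 - c) \<le> real N"
    using real_arch_simple by blast
  have "real m * (1 - c) \<ge> 2 * real k * real k \<and> m > 0" if "m \<ge> Suc N" for m
  proof -
    have "2 * real k * real k / (1 - c) \<le> real m"
      using N that by linarith
    with that c(1) show ?thesis
      by (simp add: divide_le_eq)
  qed
  then have "\<forall>\<^sub>F m in sequentially. real m * (1 - c) \<ge> 2 * real k * real k \<and> m > 0"
    unfolding eventually_sequentially by blast
  with c(2) have "\<exists>\<^sub>F m in sequentially. d * real m \<le> real (?X m) \<or> d * real m \<le> real (?Y m)"
  proof (rule frequently_rev_mp[OF frequently_eventually_frequently], intro always_eventually allI impI)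
    fix m assume "close_freq n x y t m \<le> c \<and> (real m * (1 - c) \<ge> 2 * real k * real k \<and> m > 0)"
    then have m: "close_freq n x y t m \<le> c" "real m * (1 - c) \<ge> 2 * real k * real k" "m > 0"
      by auto
    have "close_freq n x y (1 / real n ^ k) m \<le> c"
      using close_freq_mono[of "1 / real n ^ k" t n x y m] k m by simp
    then have "real (hits (\<lambda>j. \<forall>i<k. x (j + i) = y (j + i)) m) \<le> c * real m"
      using m(3) by (simp add: close_freq_power[OF assms(1)] divide_le_eq)
    then have "(1 - c) * real m \<le> real (hits (\<lambda>j. \<exists>i<k. ?D (j + i)) m)"
      using hits_not[of "\<lambda>j. \<forall>i<k. x (j + i) = y (j + i)" m] by (simp add: algebra_simps)
    also have "\<dots> \<le> real (k * (hits ?D m + k))"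
      using hits_window by (intro of_nat_mono)
    finally have *: "(1 - c) * real m \<le> real k * real (hits ?D m) + real k * real k"
      by (simp add: algebra_simps)
    have "hits ?D m \<le> ?X m + ?Y m"
      by (rule order_trans[OF hits_mono hits_disj]) auto
    then have "real k * real (hits ?D m) \<le> real (Suc k) * (real (?X m) + real (?Y m))"
      by (intro mult_mono) auto
    with * m(2) have "(1 - c) * real m \<le> 2 * real (Suc k) * (real (?X m) + real (?Y m))"
      by (simp add: algebra_simps)
    then have "2 * d * real m \<le> real (?X m) + real (?Y m)"
      by (simp add: d_def field_simps)
    then show "d * real m \<le> real (?X m) \<or> d * real m \<le> real (?Y m)"
      by linarith
  qed
  \<comment> \<open>If infinitely many \<open>m\<close> satisfy a disjunction, infinitely many
    satisfy one fixed disjunct.\<close>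
  then have "support_density d x \<or> support_density d y"
    unfolding support_density_def frequently_disj_iff .
  with that \<open>d > 0\<close> show ?thesis
    by blast
qed

section \<open>Uncountable scrambled sets\<close>

text \<open>Almost disjoint sets of even numbers, coding the initial segments of \<open>a\<close>. Keeping to even
  numbers leaves infinitely many blocks on which all points of the scrambled set vanish.\<close>
definition prefix_codes :: "nat set \<Rightarrow> nat set" where
  "prefix_codes a = range (\<lambda>k. 2 * to_nat (map (\<lambda>i. i \<in> a) [0..<k]))"

lemma odd_notin_prefix_codes: "odd k \<Longrightarrow> k \<notin> prefix_codes a"
  by (auto simp: prefix_codes_def)

text \<open>If \<open>a\<close> and \<open>b\<close> differ at \<open>i\<close>, an initial segment
  of \<open>a\<close> longer than \<open>i\<close> is no initial segment of \<open>b\<close>; there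
  are infinitely many of these, with distinct codes.\<close>

lemma infinite_prefix_codes_diff:
  assumes "a \<noteq> b"
  shows "infinite (prefix_codes a - prefix_codes b)"
proof -
  let ?c = "\<lambda>a k. 2 * to_nat (map (\<lambda>i. i \<in> a) [0..<k])"
  \<comment> \<open>A code determines its word, hence also the length \<open>k\<close> of the
    word.\<close>
  have eq: "k = k' \<and> (\<forall>i<k. i \<in> a \<longleftrightarrow> i \<in> b)" if "?c a k = ?c b k'" for a b k k'
  proof -
    have e: "map (\<lambda>i. i \<in> a) [0..<k] = map (\<lambda>i. i \<in> b) [0..<k']"
      using that by simp
    then have "k = k'"
      by (metis diff_zero length_map length_upt)
    with e show ?thesis
      by auto
  qed
  obtain i where i: "i \<in> a \<longleftrightarrow> i \<notin> b"
    using assms by blast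
  have "inj_on (?c a) {i<..}"
    by (intro inj_onI) (use eq in blast)
  then have "infinite (?c a ` {i<..})"
    by (simp add: finite_image_iff infinite_Ioi)
  moreover have "?c a ` {i<..} \<subseteq> prefix_codes a - prefix_codes b"
  proof safe
    fix k assume k: "i < k"
    show "?c a k \<in> prefix_codes a"
      by (auto simp: prefix_codes_def)
    assume "?c a k \<in> prefix_codes b"
    then obtain k' where "?c a k = ?c b k'"
      by (auto simp only: prefix_codes_def)
    from eq[OF this] k i show False
      by blast
  qed
  ultimately show ?thesis
    using infinite_super by blast
qed

lemma uncountable_UNIV_nat_set: "uncountable (UNIV :: nat set set)"
proof
  assume "countable (UNIV :: nat set set)"
  then obtain f :: "nat \<Rightarrow> nat set" where "range f = UNIV"
    using uncountable_def by fastforce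
  then show False
    using Cantors_theorem[of "UNIV :: nat set"] by auto
qed

definition block_restrict :: "(nat \<Rightarrow> nat) \<Rightarrow> (nat \<Rightarrow> nat) \<Rightarrow> nat set \<Rightarrow> nat \<Rightarrow> nat" where
  "block_restrict M x A i = (if \<exists>k\<in>A. M k \<le> i \<and> i < M (Suc k) then x i else 0)"

lemma block_restrict_in_block:
  assumes "strict_mono M" "M k \<le> i" "i < M (Suc k)"
  shows "block_restrict M x A i = (if k \<in> A then x i else 0)"
proof -
  have "k' = k" if "M k' \<le> i" "i < M (Suc k')" for k'
  proof -
    have "k < Suc k'" "k' < Suc k"
      using that assms(2,3) strict_mono_less[OF assms(1)] by (meson le_less_trans)+
    then show ?thesis
      by simp
  qed
  then have "(\<exists>k\<in>A. M k \<le> i \<and> i < M (Suc k)) \<longleftrightarrow> k \<in> A"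
    using assms(2,3) by blast
  then show ?thesis
    by (simp add: block_restrict_def)
qed

text \<open>Dense times exist beyond every bound, so they can be chosen one after another. The
  growth condition makes everything before block \<open>k\<close> at most a fraction
  \<open>1 / (k + 1)\<close> of \<open>M (Suc k)\<close>; the inner \<open>Suc\<close> forces strict
  growth even from 0.\<close>

lemma exists_sparse_dense_times:
  assumes "support_density d x"
  obtains M where "strict_mono M" "\<And>k. Suc k * Suc (M k) \<le> M (Suc k)"
    "\<And>k. d * real (M (Suc k)) \<le> real (hits (\<lambda>j. x j \<noteq> 0) (M (Suc k)))"
proof -
  \<comment> \<open>\<open>True\<close> is the trivial invariant in the form that
    \<open>dependent_nat_choice\<close> produces. The start \<open>M 0\<close> is arbitrary, so
    density is claimed only at \<open>M (Suc k)\<close>.\<close>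
  have "\<exists>M. \<forall>k. True \<and> (Suc k * Suc (M k) \<le> M (Suc k) \<and>
    d * real (M (Suc k)) \<le> real (hits (\<lambda>j. x j \<noteq> 0) (M (Suc k))))"
    using assms by (intro dependent_nat_choice)
      (auto simp: support_density_def frequently_sequentially simp del: mult_Suc)
  then obtain M where M: "\<And>k. Suc k * Suc (M k) \<le> M (Suc k)"
    "\<And>k. d * real (M (Suc k)) \<le> real (hits (\<lambda>j. x j \<noteq> 0) (M (Suc k)))"
    by blast
  have "M k < M (Suc k)" for k
    using M(1)[of k] by simp
  then have "strict_mono M"
    by (simp add: strict_mono_Suc_iff)
  with M that show ?thesis
    by blast
qed

lemma frequently_along:
  assumes "strict_mono (M :: nat \<Rightarrow> nat)" "infinite A" "\<And>k. k \<in> A \<Longrightarrow> k \<ge> N \<Longrightarrow> P (M (Suc k))"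
  shows "\<exists>\<^sub>F m in sequentially. P m"
  unfolding frequently_sequentially
proof
  fix K
  obtain k where k: "k \<in> A" "k \<ge> max N K"
    using assms(2) by (meson infinite_nat_iff_unbounded_le)
  then have "K \<le> M (Suc k)"
    using strict_mono_imp_increasing[OF assms(1), of "Suc k"] by simp
  with k assms(3) show "\<exists>m\<ge>K. P m"
    by (meson max.boundedE)
qed

text \<open>At the end of block \<open>k\<close> the frequency is nearly decided by that block. For
  \<open>k\<close> outside \<open>A \<union> B\<close> both points vanish there, so it is close to
  1; for \<open>k\<close> in \<open>A - B\<close> they differ exactly on the support of
  \<open>x\<close>, so it stays below 1.\<close>

lemma DC2_scrambled_block_restrict:
  assumes "n \<ge> 2" "d > 0" "strict_mono M" and M: "\<And>k. Suc k * Suc (M k) \<le> M (Suc k)"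
    and dens: "\<And>k. d * real (M (Suc k)) \<le> real (hits (\<lambda>j. x j \<noteq> 0) (M (Suc k)))"
    and "infinite (A - B)" "infinite (- (A \<union> B))"
  shows "DC2_scrambled n (block_restrict M x A) (block_restrict M x B)"
proof -
  let ?a = "block_restrict M x A" and ?b = "block_restrict M x B"
  have le: "M k \<le> M (Suc k)" for k
    using assms(3) by (simp add: strict_mono_leD)
  have pos: "M (Suc k) > 0" for k
    using M[of k] by simp
  have Mr: "real (Suc k) * (real (M k) + 1) \<le> real (M (Suc k))" for k
    using M[of k] by (metis of_nat_Suc of_nat_le_iff of_nat_mult add.commute)
  have split: "hits P (M (Suc k)) = hits P (M k) + hits (\<lambda>j. P (M k + j)) (M (Suc k) - M k)" for P k
    using hits_add[of P "M k" "M (Suc k) - M k"] le[of k] by simp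
  have in_block: "block_restrict M x C (M k + j) = (if k \<in> C then x (M k + j) else 0)"
    if "j < M (Suc k) - M k" for C k j
    using that assms(3) by (intro block_restrict_in_block) auto
  have "upper_dist_fun n ?a ?b t = 1" if t: "t > 0" for t
  proof (rule upper_dist_fun_eq_1I)
    fix e :: real assume "e > 0"
    obtain K where K: "1 / real n ^ K < t"
      using ex_inverse_power_less assms(1) t by blast
    \<comment> \<open>For \<open>k \<ge> N\<close> the lost positions, \<open>M k\<close> before the
      block and \<open>K\<close> at its end, make up at most a fraction \<open>e\<close> of
      \<open>M (Suc k)\<close>.\<close>
    obtain N where N: "real (Suc K) / e \<le> real N"
      using real_arch_simple by blast
    show "\<exists>\<^sub>F m in sequentially. 1 - e \<le> close_freq n ?a ?b t m"
    proof (rule frequently_along[OF assms(3) assms(7)])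
      fix k assume k: "k \<in> - (A \<union> B)" "k \<ge> N"
      let ?P = "\<lambda>j. \<forall>i<K. ?a (j + i) = ?b (j + i)"
      \<comment> \<open>The last \<open>K\<close> positions are dropped because their windows may
        run into the next block.\<close>
      have "M (Suc k) - M k - K \<le> hits (\<lambda>j. ?P (M k + j)) (M (Suc k) - M k)"
      proof -
        have "M (Suc k) - M k - K = card {..<M (Suc k) - M k - K}"
          by simp
        also have "\<dots> \<le> hits (\<lambda>j. ?P (M k + j)) (M (Suc k) - M k)"
          unfolding hits_def using k in_block by (intro card_mono) (auto simp: add.assoc)
        finally show ?thesis .
      qed
      also have "\<dots> \<le> hits ?P (M (Suc k))"
        by (simp only: split le_add2)
      finally have "real (M (Suc k)) - (real (M k) + real K) \<le> real (hits ?P (M (Suc k)))"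
        by linarith
      moreover have "real (M k) + real K \<le> e * real (M (Suc k))"
      proof -
        have "real (M k) + real K \<le> real (Suc K) * (real (M k) + 1)"
          by (simp add: algebra_simps)
        also have "\<dots> \<le> (e * real (Suc k)) * (real (M k) + 1)"
        proof (rule mult_right_mono)
          have "real (Suc K) \<le> e * real N"
            using N \<open>e > 0\<close> by (simp add: field_simps)
          also have "\<dots> \<le> e * real (Suc k)"
            using k \<open>e > 0\<close> by simp
          finally show "real (Suc K) \<le> e * real (Suc k)" .
        qed simp
        also have "\<dots> \<le> e * real (M (Suc k))"
          using Mr[of k] \<open>e > 0\<close> by (simp add: mult.assoc)
        finally show ?thesis .
      qed
      ultimately have "(1 - e) * real (M (Suc k)) \<le> real (hits ?P (M (Suc k)))"
        by (simp add: algebra_simps)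
      then have "1 - e \<le> close_freq n ?a ?b (1 / real n ^ K) (M (Suc k))"
        using pos[of k] by (simp add: close_freq_power[OF assms(1)] le_divide_eq)
      also have "\<dots> \<le> close_freq n ?a ?b t (M (Suc k))"
        using K by (intro close_freq_mono) simp
      finally show "1 - e \<le> close_freq n ?a ?b t (M (Suc k))" .
    qed
  qed
  \<comment> \<open>At threshold \<open>1 / n\<close> windows have length 1, so the frequency counts
    single equal coordinates.\<close>
  moreover have "lower_dist_fun n ?a ?b (1 / real n ^ 1) < 1"
    unfolding lower_dist_fun_less_1_iff
  proof (intro exI[of _ "1 - d / 2"] conjI)
    \<comment> \<open>For \<open>k \<ge> N\<close> the part before block \<open>k\<close> costs at
      most half of the density \<open>d\<close>.\<close>
    obtain N where N: "2 / d \<le> real N"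
      using real_arch_simple by blast
    show "\<exists>\<^sub>F m in sequentially. close_freq n ?a ?b (1 / real n ^ 1) m \<le> 1 - d / 2"
    proof (rule frequently_along[OF assms(3) assms(6)])
      fix k assume k: "k \<in> A - B" "k \<ge> N"
      let ?D = "\<lambda>j. ?a j \<noteq> ?b j"
      have "hits (\<lambda>j. x j \<noteq> 0) (M (Suc k)) \<le>
          M k + hits (\<lambda>j. x (M k + j) \<noteq> 0) (M (Suc k) - M k)"
        by (simp add: split hits_le)
      also have "hits (\<lambda>j. x (M k + j) \<noteq> 0) (M (Suc k) - M k) \<le>
          hits (\<lambda>j. ?D (M k + j)) (M (Suc k) - M k)"
        using k in_block by (intro hits_mono) auto
      also have "\<dots> \<le> hits ?D (M (Suc k))"
        by (simp only: split le_add2)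
      finally have "d * real (M (Suc k)) \<le> real (M k) + real (hits ?D (M (Suc k)))"
        using dens[of k] by linarith
      moreover have "real (M k) \<le> d / 2 * real (M (Suc k))"
      proof -
        have "2 \<le> d * real N"
          using N assms(2) by (simp add: field_simps)
        also have "\<dots> \<le> d * real (Suc k)"
          using k assms(2) by simp
        finally have "1 * (real (M k) + 1) \<le> d / 2 * real (Suc k) * (real (M k) + 1)"
          by (intro mult_right_mono) auto
        also have "\<dots> \<le> d / 2 * real (M (Suc k))"
          unfolding mult.assoc[of "d / 2"] using Mr[of k] assms(2) by (intro mult_left_mono) auto
        finally show ?thesis
          by simp
      qed
      ultimately have "real (hits (\<lambda>j. ?a j = ?b j) (M (Suc k))) \<le> (1 - d / 2) * real (M (Suc k))"
        using hits_not[of "\<lambda>j. ?a j = ?b j" "M (Suc k)"] by (simp add: algebra_simps)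
      then show "close_freq n ?a ?b (1 / real n ^ 1) (M (Suc k)) \<le> 1 - d / 2"
        using pos[of k] by (subst close_freq_power[OF assms(1)]) (simp add: divide_le_eq)
    qed
  qed (use assms(2) in simp)
  moreover have "1 / real n ^ 1 > 0"
    using assms(1) by simp
  ultimately show ?thesis
    unfolding DC2_scrambled_def by blast
qed

section \<open>The scrambled family inside a hereditary subshift\<close>

lemma full_shift_iff: "w \<in> full_shift n \<longleftrightarrow> (\<forall>i. w i < n)"
  by (auto simp: full_shift_topology_def PiE_def Pi_def)

lemma subshift_subset: "subshift n X \<Longrightarrow> X \<subseteq> full_shift n"
  by (simp add: subshift_def closedin_subset)

lemma hereditary_le:
  assumes "subshift n X" "hereditary n X" "w \<in> X" "\<And>i. v i \<le> w i"
  shows "v \<in> X"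
proof -
  have "w i < n" for i
    using subshift_subset[OF assms(1)] assms(3) full_shift_iff by blast
  then have "v \<in> full_shift n"
    unfolding full_shift_iff using assms(4) le_less_trans by blast
  with assms show ?thesis
    by (auto simp: hereditary_def)
qed

lemma support_density_imp_DC2_chaotic:
  assumes "n \<ge> 2" "subshift n X" "hereditary n X" "x \<in> X" "d > 0" "support_density d x"
  shows "DC2_chaotic n X"
proof -
  obtain M where M: "strict_mono M" "\<And>k. Suc k * Suc (M k) \<le> M (Suc k)"
    "\<And>k. d * real (M (Suc k)) \<le> real (hits (\<lambda>j. x j \<noteq> 0) (M (Suc k)))"
    using exists_sparse_dense_times[OF assms(6)] by metis
  let ?p = "\<lambda>a. block_restrict M x (prefix_codes a)"
  have infin: "infinite (- (prefix_codes a \<union> prefix_codes b))" for a b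
  proof (rule infinite_super)
    show "range (\<lambda>k. 2 * k + 1) \<subseteq> - (prefix_codes a \<union> prefix_codes b)"
      using odd_notin_prefix_codes by auto
    show "infinite (range (\<lambda>k::nat. 2 * k + 1))"
      by (intro range_inj_infinite) (auto simp: inj_on_def)
  qed
  have scr: "DC2_scrambled n (?p a) (?p b)" if "a \<noteq> b" for a b
    using DC2_scrambled_block_restrict[OF assms(1,5) M infinite_prefix_codes_diff[OF that] infin] .
  \<comment> \<open>Equal images of distinct \<open>a\<close> and \<open>b\<close> would be a point
    scrambled with itself.\<close>
  have "inj ?p"
  proof (rule injI, rule ccontr)
    fix a b assume "?p a = ?p b" "a \<noteq> b"
    then show False
      using scr[of a b] not_DC2_scrambled_refl[of n "?p b"] by simp
  qed
  then have "uncountable (range ?p)"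
    using uncountable_UNIV_nat_set by (metis countable_image_inj_eq)
  moreover have "range ?p \<subseteq> X"
    using hereditary_le[OF assms(2-4)] by (auto simp: block_restrict_def)
  moreover have "DC2_scrambled n u v" if uv: "u \<in> range ?p" "v \<in> range ?p" "u \<noteq> v" for u v
  proof -
    obtain a b where "u = ?p a" "v = ?p b"
      using uv(1,2) by auto
    with uv(3) scr[of a b] show ?thesis
      by fastforce
  qed
  ultimately show ?thesis
    unfolding DC2_chaotic_def by (intro exI[of _ "range ?p"]) simp
qed

section \<open>Entropy\<close>

text \<open>Fekete's lemma: the limit is the infimum of the averages. It is needed because
  \<open>lim\<close> carries information only for convergent sequences.\<close>

lemma convergent_subadditive_average:
  fixes u :: "nat \<Rightarrow> real"
  assumes nonneg: "\<And>m. 0 \<le> u m" and subadd: "\<And>m k. u (m + k) \<le> u m + u k"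
  shows "convergent (\<lambda>m. u m / real m)"
proof -
  define L where "L = (INF m\<in>{1..}. u m / real m)"
  have bdd: "bdd_below ((\<lambda>m. u m / real m) ` {1..})"
    by (rule bdd_belowI2[of _ 0]) (simp add: nonneg)
  have L_le: "L \<le> u m / real m" if "m \<ge> 1" for m
    unfolding L_def using that by (intro cINF_lower[OF bdd]) auto
  have "(\<lambda>m. u m / real m) \<longlonglongrightarrow> L"
  proof (rule LIMSEQ_I)
    fix e :: real assume "e > 0"
    then have "L < L + e / 2"
      by simp
    then obtain N where N: "N \<ge> 1" "u N / real N < L + e / 2"
      unfolding L_def by (subst (asm) cINF_less_iff[OF _ bdd]) auto
    \<comment> \<open>A bound for \<open>u\<close> at every remainder modulo
      \<open>N\<close>.\<close>
    define C where "C = (\<Sum>r<N. u r)"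
    have mult: "u (q * N + r) \<le> real q * u N + u r" for q r
    proof (induction q)
      case (Suc q)
      have "u (Suc q * N + r) \<le> u N + u (q * N + r)"
        using subadd[of N "q * N + r"] by (simp add: add.assoc)
      with Suc show ?case
        by (simp add: algebra_simps)
    qed simp
    have bound: "u m \<le> real m * (u N / real N) + C" for m
    proof -
      have "u m \<le> real (m div N) * u N + u (m mod N)"
        using mult[of "m div N" "m mod N"] by simp
      moreover have "u (m mod N) \<le> C"
        unfolding C_def using N(1) nonneg by (intro member_le_sum) auto
      moreover have "real (m div N) * u N \<le> real m / real N * u N"
        using nonneg of_nat_div_le_of_nat[of m N] by (intro mult_right_mono) auto
      ultimately show ?thesis
        by simp
    qed
    obtain K where K: "2 * C / e < real K"
      using reals_Archimedean2 by blast
    show "\<exists>K. \<forall>m\<ge>K. norm (u m / real m - L) < e"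
    proof (intro exI[of _ "Suc K"] allI impI)
      fix m assume m: "m \<ge> Suc K"
      have "2 * C / e < real m"
        using m K by linarith
      then have "C / real m < e / 2"
        using m \<open>e > 0\<close> by (simp add: field_simps)
      moreover have "u m / real m \<le> u N / real N + C / real m"
        using bound[of m] m by (simp add: field_simps)
      moreover have "L \<le> u m / real m"
        using L_le m by simp
      ultimately show "norm (u m / real m - L) < e"
        using N(2) unfolding real_norm_def by linarith
    qed
  qed
  then show ?thesis
    by (rule convergentI)
qed

section \<open>Words of a subshift and the entropy limit\<close>

lemma shift_funpow_in:
  assumes "subshift n X" "x \<in> X"
  shows "(\<lambda>j. x (i + j)) \<in> X"
proof (induction i)
  case (Suc i)
  then have "shift (\<lambda>j. x (i + j)) \<in> X"
    using assms(1) by (auto simp: subshift_def)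
  then show ?case
    by (simp add: shift_def)
qed (use assms in simp)

text \<open>Shift invariance moves every occurrence of a word to position 0.\<close>

lemma language_eq:
  assumes "subshift n X"
  shows "language X k = (\<lambda>x. map x [0..<k]) ` X"
proof
  show "language X k \<subseteq> (\<lambda>x. map x [0..<k]) ` X"
    using shift_funpow_in[OF assms] by (fastforce simp: language_def)
  have "map x [0..<k] \<in> language X k" if "x \<in> X" for x
    unfolding language_def using that by (auto intro!: exI[of _ x] exI[of _ 0])
  then show "(\<lambda>x. map x [0..<k]) ` X \<subseteq> language X k"
    by auto
qed

lemma language_subset:
  assumes "subshift n X"
  shows "language X k \<subseteq> {xs. set xs \<subseteq> {..<n} \<and> length xs = k}"
  using subshift_subset[OF assms] unfolding language_eq[OF assms] full_shift_iff[abs_def] subset_iff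
  by (auto simp: full_shift_iff)

lemma finite_language: "subshift n X \<Longrightarrow> finite (language X k)"
  using language_subset finite_lists_length_eq finite_subset by (metis finite_lessThan)

lemma card_language_pos:
  assumes "subshift n X"
  shows "card (language X k) > 0"
  using assms finite_language[OF assms] language_eq[OF assms] by (auto simp: card_gt_0_iff subshift_def)

text \<open>Cutting a word after \<open>m\<close> letters is injective and both pieces are again
  words of \<open>X\<close>.\<close>

lemma card_language_add_le:
  assumes "subshift n X"
  shows "card (language X (m + k)) \<le> card (language X m) * card (language X k)"
proof -
  let ?f = "\<lambda>w. (take m w, drop m w)"
  have "inj ?f"
    by (auto intro!: injI) (metis append_take_drop_id)
  then have "inj_on ?f (language X (m + k))"
    by (rule inj_on_subset) simp
  moreover have "?f ` language X (m + k) \<subseteq> language X m \<times> language X k"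
  proof -
    have "map (\<lambda>j. w (i + j)) [m..<m + k] = map (\<lambda>j. w (i + m + j)) [0..<k]" for w :: "nat \<Rightarrow> nat" and i
      by (rule nth_equalityI) (auto simp: add.assoc)
    then show ?thesis
      unfolding language_def by (auto simp: take_map drop_map) blast+
  qed
  ultimately have "card (language X (m + k)) \<le> card (language X m \<times> language X k)"
    using finite_language[OF assms] by (intro card_inj_on_le) auto
  then show ?thesis
    by (simp add: card_cartesian_product)
qed

lemma LIMSEQ_topological_entropy:
  assumes "subshift n X"
  shows "(\<lambda>k. log 2 (real (card (language X k))) / real k) \<longlonglongrightarrow> topological_entropy X"
proof -
  have pos: "card (language X k) > 0" for k
    by (rule card_language_pos[OF assms])
  have "convergent (\<lambda>k. log 2 (real (card (language X k))) / real k)"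
  proof (rule convergent_subadditive_average)
    show "0 \<le> log 2 (real (card (language X m)))" for m
      using pos[of m] by simp
    show "log 2 (real (card (language X (m + k)))) \<le>
        log 2 (real (card (language X m))) + log 2 (real (card (language X k)))" for m k
    proof -
      have "log 2 (real (card (language X (m + k)))) \<le>
          log 2 (real (card (language X m) * card (language X k)))"
        using card_language_add_le[OF assms, of m k] pos[of m] pos[of k] pos[of "m + k"]
        by (subst log_le_cancel_iff) (simp_all flip: of_nat_mult)
      also have "\<dots> = log 2 (real (card (language X m))) + log 2 (real (card (language X k)))"
        using pos[of m] pos[of k] by (simp add: log_mult)
      finally show ?thesis .
    qed
  qed
  then show ?thesis
    unfolding topological_entropy_def by (simp add: convergent_LIMSEQ_iff)
qed

lemma support_density_imp_entropy_pos:
  assumes "subshift n X" "hereditary n X" "x \<in> X" "d > 0" "support_density d x"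
  shows "topological_entropy X > 0"
proof -
  have card: "2 ^ hits (\<lambda>j. x j \<noteq> 0) m \<le> card (language X m)" for m
  proof -
    let ?S = "{j. j < m \<and> x j \<noteq> 0}"
    let ?r = "\<lambda>B j. if j \<in> B then x j else 0"
    let ?w = "\<lambda>B. map (?r B) [0..<m]"
    \<comment> \<open>\<open>x\<close> is nonzero on \<open>?S\<close>, so \<open>B\<close> can be
      read off as the set of nonzero positions of its word.\<close>
    have "B = B'" if "B \<in> Pow ?S" "B' \<in> Pow ?S" "?w B = ?w B'" for B B'
    proof (rule set_eqI)
      fix j
      show "j \<in> B \<longleftrightarrow> j \<in> B'"
      proof (cases "j \<in> ?S")
        case True
        then have "?r B j = ?r B' j"
          using that(3) by auto
        with True show ?thesis
          by (auto split: if_splits)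
      qed (use that in auto)
    qed
    then have "inj_on ?w (Pow ?S)"
      by (intro inj_onI)
    moreover have "?r B \<in> X" for B
      by (rule hereditary_le[OF assms(1-3)]) simp
    then have "?w ` Pow ?S \<subseteq> language X m"
      unfolding language_eq[OF assms(1)] by blast
    ultimately have "card (Pow ?S) \<le> card (language X m)"
      using finite_language[OF assms(1)] by (intro card_inj_on_le)
    then show ?thesis
      by (simp add: card_Pow hits_def)
  qed
  have log: "real (hits (\<lambda>j. x j \<noteq> 0) m) \<le> log 2 (real (card (language X m)))" for m
  proof (rule le_log_of_power)
    have "real (2 ^ hits (\<lambda>j. x j \<noteq> 0) m) \<le> real (card (language X m))"
      using card by (rule of_nat_mono)
    then show "2 ^ hits (\<lambda>j. x j \<noteq> 0) m \<le> real (card (language X m))"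
      by simp
  qed simp
  have "\<exists>\<^sub>F m in sequentially. d * real m \<le> real (hits (\<lambda>j. x j \<noteq> 0) m) \<and> m > 0"
    using assms(5) unfolding support_density_def
    by (intro frequently_eventually_frequently eventually_gt_at_top)
  then have freq: "\<exists>\<^sub>F m in sequentially. d \<le> log 2 (real (card (language X m))) / real m"
  proof (rule frequently_elim1)
    fix m assume "d * real m \<le> real (hits (\<lambda>j. x j \<noteq> 0) m) \<and> m > 0"
    then show "d \<le> log 2 (real (card (language X m))) / real m"
      using log[of m] by (simp add: le_divide_eq)
  qed
  \<comment> \<open>The bound is known only for infinitely many \<open>m\<close>; convergence
    carries it to the limit.\<close>
  have "d \<le> topological_entropy X"
  proof (rule ccontr)
    assume "\<not> d \<le> topological_entropy X"
    then have "\<forall>\<^sub>F m in sequentially. log 2 (real (card (language X m))) / real m < d"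
      using order_tendstoD(2)[OF LIMSEQ_topological_entropy[OF assms(1)]] by simp
    with freq show False
      by (simp add: frequently_def not_le)
  qed
  with assms(4) show ?thesis
    by simp
qed

text \<open>The points all of whose prefixes up to length \<open>L\<close> have density at least
  \<open>b\<close> form decreasing closed sets with empty intersection; by compactness one of them
  is empty.\<close>

lemma uniform_sparse_prefix:
  assumes "subshift n X"
    and none: "\<And>x. x \<in> X \<Longrightarrow> \<exists>l. real (hits (\<lambda>j. x j \<noteq> 0) l) < b * real l"
  obtains L where "\<And>x. x \<in> X \<Longrightarrow> \<exists>l\<le>L. real (hits (\<lambda>j. x j \<noteq> 0) l) < b * real l"
proof -
  let ?T = "full_shift_topology n"
  let ?h = "\<lambda>x l. real (hits (\<lambda>j. x j \<noteq> 0) l)"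
  define C where "C L = {x \<in> X. \<forall>l\<le>L. b * real l \<le> ?h x l}" for L
  have compact: "compact_space ?T"
    unfolding full_shift_topology_def
    by (simp add: compact_space_product_topology compact_space_discrete_topology)
  \<comment> \<open>The count is a finite sum of functions of one coordinate, each continuous
    because the alphabet is discrete.\<close>
  have cont: "continuous_map ?T euclideanreal (\<lambda>x. ?h x l)" for l
  proof -
    have "continuous_map ?T euclideanreal (\<lambda>x. if x j \<noteq> 0 then 1 else 0)" for j
    proof -
      have "continuous_map ?T (discrete_topology {..<n}) (\<lambda>x. x j)"
        unfolding full_shift_topology_def by (rule continuous_map_product_projection) simp
      moreover have "continuous_map (discrete_topology {..<n}) euclideanreal (\<lambda>a. if a \<noteq> 0 then 1 else 0)"
        by simp
      ultimately show ?thesis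
        by (rule continuous_map_compose[unfolded o_def])
    qed
    then have "continuous_map ?T euclideanreal (\<lambda>x. \<Sum>j<l. if x j \<noteq> 0 then 1 else 0)"
      by (intro continuous_map_sum) auto
    moreover have "?h x l = (\<Sum>j<l. if x j \<noteq> 0 then 1 else 0)" for x :: "nat \<Rightarrow> nat"
      unfolding hits_eq_sum of_nat_sum by (intro sum.cong) auto
    ultimately show ?thesis
      by (simp only:)
  qed
  have closed: "closedin ?T (C L)" for L
  proof -
    have "closedin ?T {x \<in> topspace ?T. ?h x l \<in> {b * real l..}}" for l
      by (rule closedin_continuous_map_preimage[OF cont]) simp
    then have "closedin ?T (X \<inter> (\<Inter>l\<in>{..L}. {x \<in> topspace ?T. ?h x l \<in> {b * real l..}}))"
      using assms(1) by (intro closedin_Int closedin_Inter) (auto simp: subshift_def)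
    also have "X \<inter> (\<Inter>l\<in>{..L}. {x \<in> topspace ?T. ?h x l \<in> {b * real l..}}) = C L"
      using subshift_subset[OF assms(1)] by (auto simp: C_def)
    finally show ?thesis .
  qed
  have dec: "decseq C"
    by (auto simp: decseq_def C_def)
  have "(\<Inter>L. C L) = {}"
  proof (rule ccontr)
    assume "(\<Inter>L. C L) \<noteq> {}"
    then obtain x where x: "x \<in> C L" for L
      by blast
    then have "b * real l \<le> ?h x l" for l
      unfolding C_def by blast
    moreover have "x \<in> X"
      using x[of 0] by (simp add: C_def)
    ultimately show False
      using none[of x] by (simp add: not_less[symmetric])
  qed
  then obtain L where "C L = {}"
    using compact_space_imp_nest[OF compact closed _ dec] by metis
  then have "\<exists>l\<le>L. ?h x l < b * real l" if "x \<in> X" for x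
    using that unfolding C_def not_le[symmetric] by blast
  with that show ?thesis
    by blast
qed

text \<open>Sparse prefixes of length at most \<open>L\<close> are cut off repeatedly, the rest
  staying in \<open>X\<close> by shift invariance. The final piece, of length at most
  \<open>L\<close>, costs at most \<open>L\<close>.\<close>

lemma uniform_support_bound:
  assumes "subshift n X" "b > 0"
    and none: "\<And>x. x \<in> X \<Longrightarrow> \<exists>l. real (hits (\<lambda>j. x j \<noteq> 0) l) < b * real l"
  obtains L where "\<And>x m. x \<in> X \<Longrightarrow> real (hits (\<lambda>j. x j \<noteq> 0) m) \<le> b * real m + real L"
proof -
  obtain L where L: "\<And>x. x \<in> X \<Longrightarrow> \<exists>l\<le>L. real (hits (\<lambda>j. x j \<noteq> 0) l) < b * real l"
    using uniform_sparse_prefix[OF assms(1) none] by metis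
  have "real (hits (\<lambda>j. x j \<noteq> 0) m) \<le> b * real m + real L" if "x \<in> X" for x m
    using that
  proof (induction m arbitrary: x rule: less_induct)
    case (less m)
    show ?case
    proof (cases "m \<le> L")
      case True
      then have "real (hits (\<lambda>j. x j \<noteq> 0) m) \<le> real L"
        using hits_le[of "\<lambda>j. x j \<noteq> 0" m] by linarith
      moreover have "0 \<le> b * real m"
        using assms(2) by simp
      ultimately show ?thesis
        by linarith
    next
      case False
      obtain l where l: "l \<le> L" "real (hits (\<lambda>j. x j \<noteq> 0) l) < b * real l"
        using L less.prems by blast
      \<comment> \<open>The strict inequality fails for \<open>l = 0\<close>, so each cut really
        shortens the word.\<close>
      have "l > 0"
        using l(2) by (cases l) auto
      have "real (hits (\<lambda>j. x (l + j) \<noteq> 0) (m - l)) \<le> b * real (m - l) + real L"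
        using False \<open>l > 0\<close> shift_funpow_in[OF assms(1) less.prems] by (intro less.IH) auto
      moreover have "hits (\<lambda>j. x j \<noteq> 0) m = hits (\<lambda>j. x j \<noteq> 0) l + hits (\<lambda>j. x (l + j) \<noteq> 0) (m - l)"
        using hits_add[of "\<lambda>j. x j \<noteq> 0" l "m - l"] False l(1) by simp
      moreover have "b * real m = b * real l + b * real (m - l)"
        using False l(1) by (simp add: of_nat_diff algebra_simps)
      ultimately show ?thesis
        using l(2) by linarith
    qed
  qed
  with that show ?thesis
    by blast
qed

text \<open>The weight of a word is a product over its letters, and one position contributes 1 for
  the letter 0 and \<open>q\<close> for each of the \<open>N\<close> others.\<close>

lemma sum_power_nonzero_letters:
  fixes q :: real
  shows "(\<Sum>xs | set xs \<subseteq> {..<Suc N} \<and> length xs = m. q ^ length (filter (\<lambda>a. a \<noteq> 0) xs)) =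
    (1 + real N * q) ^ m"
proof (induction m)
  case 0
  have "{xs. set xs \<subseteq> {..<Suc N} \<and> length xs = 0} = {[]}"
    by auto
  then show ?case
    by simp
next
  case (Suc m)
  let ?W = "{xs. set xs \<subseteq> {..<Suc N} \<and> length xs = m}"
  let ?g = "\<lambda>xs. q ^ length (filter (\<lambda>a. a \<noteq> 0) xs)"
  have "(\<Sum>xs | set xs \<subseteq> {..<Suc N} \<and> length xs = Suc m. ?g xs) =
      (\<Sum>(xs, a)\<in>?W \<times> {..<Suc N}. ?g (a # xs))"
    unfolding lists_length_Suc_eq by (subst sum.reindex) (auto simp: inj_on_def intro!: sum.cong)
  also have "\<dots> = (\<Sum>xs\<in>?W. \<Sum>a<Suc N. ?g (a # xs))"
    by (simp only: sum.cartesian_product)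
  also have "\<dots> = (\<Sum>xs\<in>?W. (1 + real N * q) * ?g xs)"
    by (intro sum.cong refl, subst sum.lessThan_Suc_shift) (simp add: algebra_simps)
  also have "\<dots> = (1 + real N * q) ^ Suc m"
    by (simp only: sum_distrib_left[symmetric] Suc power_Suc)
  finally show ?case .
qed

lemma length_filter_map_upt: "length (filter (\<lambda>a. a \<noteq> 0) (map x [0..<m])) = hits (\<lambda>j. x j \<noteq> 0) m"
  by (induction m) auto

text \<open>Since \<open>q \<le> 1\<close>, a word with at most \<open>B\<close> nonzero letters
  weighs at least \<open>q powr B\<close>, while all words over the alphabet together weigh the
  right-hand side.\<close>

lemma card_language_le:
  fixes q :: real
  assumes "n \<ge> 2" "subshift n X" "0 < q" "q \<le> 1"
    and bound: "\<And>x. x \<in> X \<Longrightarrow> real (hits (\<lambda>j. x j \<noteq> 0) m) \<le> B"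
  shows "real (card (language X m)) * q powr B \<le> (1 + real (n - 1) * q) ^ m"
proof -
  let ?g = "\<lambda>xs. q ^ length (filter (\<lambda>a. a \<noteq> 0) xs)"
  have n: "Suc (n - 1) = n"
    using assms(1) by simp
  have "real (card (language X m)) * q powr B = (\<Sum>xs\<in>language X m. q powr B)"
    by simp
  also have "\<dots> \<le> (\<Sum>xs\<in>language X m. ?g xs)"
  proof (rule sum_mono)
    fix xs assume "xs \<in> language X m"
    then obtain x where x: "x \<in> X" "xs = map x [0..<m]"
      unfolding language_eq[OF assms(2)] by blast
    have "q powr B \<le> q powr real (hits (\<lambda>j. x j \<noteq> 0) m)"
      using bound[OF x(1)] assms(3,4) by (intro powr_mono') auto
    then show "q powr B \<le> ?g xs"
      unfolding x(2) length_filter_map_upt using assms(3) by (simp add: powr_realpow)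
  qed
  also have "\<dots> \<le> (\<Sum>xs | set xs \<subseteq> {..<n} \<and> length xs = m. ?g xs)"
    using language_subset[OF assms(2)] assms(3)
    by (intro sum_mono2 finite_lists_length_eq) auto
  also have "\<dots> = (1 + real (n - 1) * q) ^ m"
    using sum_power_nonzero_letters[where N = "n - 1" and m = m and q = q] unfolding n .
  finally show ?thesis .
qed

text \<open>Take logarithms in \<open>card_language_le\<close> and divide by \<open>m\<close>; the
  contribution of \<open>L\<close> tends to 0.\<close>

lemma topological_entropy_le:
  fixes q :: real
  assumes "n \<ge> 2" "subshift n X" "0 < q" "q \<le> 1"
    and bound: "\<And>x m. x \<in> X \<Longrightarrow> real (hits (\<lambda>j. x j \<noteq> 0) m) \<le> b * real m + real L"
  shows "topological_entropy X \<le> log 2 (1 + real (n - 1) * q) + b * log 2 (1 / q)"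
proof -
  let ?c = "1 + real (n - 1) * q"
  have c: "?c > 0"
    using assms(3) by (simp add: add_pos_nonneg)
  have le: "log 2 (real (card (language X m))) / real m \<le>
      log 2 ?c + b * log 2 (1 / q) + real L * log 2 (1 / q) / real m" if "m \<ge> 1" for m
  proof -
    have pos: "real (card (language X m)) > 0"
      using card_language_pos[OF assms(2)] by simp
    have "log 2 (real (card (language X m)) * q powr (b * real m + real L)) \<le> log 2 (?c ^ m)"
      using card_language_le[OF assms(1-4) bound] pos c assms(3) by (subst log_le_cancel_iff) auto
    then have "log 2 (real (card (language X m))) + (b * real m + real L) * log 2 q \<le> real m * log 2 ?c"
      using pos c assms(3) by (simp add: log_mult log_powr log_nat_power)
    then show ?thesis
      using that assms(3) by (simp add: log_divide field_simps)
  qed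
  have "(\<lambda>m. log 2 ?c + b * log 2 (1 / q) + real L * log 2 (1 / q) / real m)
      \<longlonglongrightarrow> log 2 ?c + b * log 2 (1 / q) + 0"
    by (intro tendsto_add tendsto_const lim_const_over_n)
  from LIMSEQ_le[OF LIMSEQ_topological_entropy[OF assms(2)] this] le show ?thesis
    by auto
qed

lemma entropy_pos_imp_support_density:
  assumes "n \<ge> 2" "subshift n X" "topological_entropy X > 0"
  obtains x d where "x \<in> X" "d > 0" "support_density d x"
proof -
  define h where "h = topological_entropy X"
  \<comment> \<open>Chosen so that \<open>1 + (n - 1) * q\<close> is at most
    \<open>2 powr (h / 3)\<close>; the minimum with 1 keeps \<open>log 2 (1 / q)\<close>
    nonnegative.\<close>
  define q where "q = min 1 ((2 powr (h / 3) - 1) / real n)"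
  \<comment> \<open>Makes \<open>b * log 2 (1 / q)\<close> at most \<open>h / 3\<close>, the added 1
    guarding against a zero denominator. Were there no point with all prefixes of density at least
    \<open>b\<close>, the entropy \<open>h\<close> would be at most
    \<open>2 * h / 3\<close>.\<close>
  define b where "b = h / (3 * (log 2 (1 / q) + 1))"
  have h: "h > 0"
    using assms(3) by (simp add: h_def)
  have pw: "2 powr (h / 3) > 1"
    using h by (simp add: gr_one_powr)
  then have q: "0 < q" "q \<le> 1"
    using assms(1) by (auto simp: q_def)
  have lq: "log 2 (1 / q) \<ge> 0"
    using q by simp
  have "b > 0"
    using h lq by (simp add: b_def)
  have "\<exists>x\<in>X. \<forall>l. b * real l \<le> real (hits (\<lambda>j. x j \<noteq> 0) l)"
  proof (rule ccontr)
    assume "\<not> ?thesis"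
    then have "\<exists>l. real (hits (\<lambda>j. x j \<noteq> 0) l) < b * real l" if "x \<in> X" for x
      using that by (auto simp: not_le)
    then obtain L where "\<And>x m. x \<in> X \<Longrightarrow> real (hits (\<lambda>j. x j \<noteq> 0) m) \<le> b * real m + real L"
      using uniform_support_bound[OF assms(2) \<open>b > 0\<close>] by blast
    then have "h \<le> log 2 (1 + real (n - 1) * q) + b * log 2 (1 / q)"
      unfolding h_def by (rule topological_entropy_le[OF assms(1,2) q])
    moreover have "log 2 (1 + real (n - 1) * q) \<le> h / 3"
    proof -
      have "real (n - 1) * q \<le> real n * ((2 powr (h / 3) - 1) / real n)"
        using q by (intro mult_mono) (auto simp: q_def)
      then have "1 + real (n - 1) * q \<le> 2 powr (h / 3)"
        using assms(1) by simp
      moreover have "1 + real (n - 1) * q > 0"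
        using q by (simp add: add_pos_nonneg)
      ultimately show ?thesis
        using less_log_iff[of 2 "1 + real (n - 1) * q" "h / 3"] by (simp add: not_less[symmetric])
    qed
    moreover have "b * log 2 (1 / q) \<le> h / 3"
    proof -
      have "b * log 2 (1 / q) \<le> b * (log 2 (1 / q) + 1)"
        using \<open>b > 0\<close> by simp
      also have "\<dots> = h / 3"
        using lq by (simp add: b_def field_simps)
      finally show ?thesis .
    qed
    ultimately show False
      using h by linarith
  qed
  then obtain x where "x \<in> X" "\<And>l. b * real l \<le> real (hits (\<lambda>j. x j \<noteq> 0) l)"
    by blast
  with that \<open>b > 0\<close> show ?thesis
    by (auto simp: support_density_def)
qed

theorem theorem23:
  fixes n :: nat and X :: "(nat \<Rightarrow> nat) set"
  assumes "n \<ge> 2" and "subshift n X" and "hereditary n X"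
  shows "(topological_entropy X > 0 \<longleftrightarrow>
            (\<exists>x\<in>X. \<exists>y\<in>X. \<exists>t>0. lower_dist_fun n x y t < 1)) \<and>
         ((\<exists>x\<in>X. \<exists>y\<in>X. \<exists>t>0. lower_dist_fun n x y t < 1) \<longleftrightarrow> DC3_chaotic n X) \<and>
         (DC3_chaotic n X \<longleftrightarrow> DC2_chaotic n X)"
proof -
  \<comment> \<open>\<open>?dense\<close> is the hub: it is equivalent to positive entropy and
    closes the cycle \<open>?dense\<close>, DC2, DC3, \<open>?pair\<close>,
    \<open>?dense\<close>.\<close>
  let ?dense = "\<exists>x\<in>X. \<exists>d>0. support_density d x"
  let ?pair = "\<exists>x\<in>X. \<exists>y\<in>X. \<exists>t>0. lower_dist_fun n x y t < 1"
  have "?dense" if "topological_entropy X > 0"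
    by (rule entropy_pos_imp_support_density[OF assms(1,2) that]) blast
  moreover have "topological_entropy X > 0" if "?dense"
    using that support_density_imp_entropy_pos[OF assms(2,3)] by blast
  moreover have "DC2_chaotic n X" if "?dense"
    using that support_density_imp_DC2_chaotic[OF assms] by blast
  moreover have "DC3_chaotic n X" if "DC2_chaotic n X"
    using that DC2_scrambled_imp_DC3_scrambled unfolding DC2_chaotic_def DC3_chaotic_def by meson
  moreover have "?pair" if chaotic: "DC3_chaotic n X"
  proof -
    obtain S where S: "S \<subseteq> X" "uncountable S"
      "\<And>x y. x \<in> S \<Longrightarrow> y \<in> S \<Longrightarrow> x \<noteq> y \<Longrightarrow> DC3_scrambled n x y"
      using chaotic by (auto simp: DC3_chaotic_def)
    have "infinite S"
      using S(2) countable_finite by blast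
    then obtain x where "x \<in> S"
      by (metis ex_in_conv finite.emptyI)
    moreover obtain y where "y \<in> S - {x}"
      using \<open>infinite S\<close> by (metis ex_in_conv finite.emptyI infinite_remove)
    ultimately obtain t where "t > 0" "lower_dist_fun n x y t < 1"
      using S(3) DC3_scrambled_imp_lower_less_1 by (metis DiffE insertI1)
    with \<open>x \<in> S\<close> \<open>y \<in> S - {x}\<close> S(1) show ?thesis
      by blast
  qed
  moreover have "?dense" if pair: "?pair"
  proof -
    obtain x y t where "x \<in> X" "y \<in> X" "t > 0" "lower_dist_fun n x y t < 1"
      using pair by blast
    then show ?thesis
      by (metis lower_less_1_imp_support_density[OF assms(1)] empty_iff insert_iff)
  qed
  ultimately show ?thesis
    by blast
qed

end
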